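(* For all $n\ge1$ and all $k$, the number of bi-increasing permutations $\pi\in{\cal S}_n$ with ${\sf dexc}(\pi)=k$ equals the number of bi-increasing permutations $\pi\in{\cal S}_n$ with ${\sf ddes}(\pi)=k$.
   Context: Permutations $\pi\in{\cal S}_n$ are written as words $\pi_1\cdots\pi_n$. An excedance of $\pi$ is an integer $i\in[n-1]$ with $\pi_i>i$; ${\sf E}(\pi)$ is the set of excedances and ${\sf dexc}(\pi)=\sum_{i\in{\sf E}(\pi)}(\pi_i-i)$. A descent is an $i\in[n-1]$ with $\pi_i>\pi_{i+1}$; ${\sf D}(\pi)$ is the set of descents and ${\sf ddes}(\pi)=\sum_{i\in{\sf D}(\pi)}(\pi_i-\pi_{i+1})$. ${\sf inv}(\pi)$ is the number of pairs $i<j$ with $\pi_i>\pi_j$. A permutation is bi-increasing if ${\sf inv}(\pi)={\sf dexc}(\pi)$. *)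

theory Defs
  imports "HOL-Combinatorics.Permutations"
begin

text \<open>
  A permutation in $S_n$ is a function \<open>p :: nat \<Rightarrow> nat\<close> with \<open>p permutes {1..n}\<close>;
  its word is \<open>p 1, \<dots>, p n\<close>.
\<close>

definition excedances :: "nat \<Rightarrow> (nat \<Rightarrow> nat) \<Rightarrow> nat set" where
  "excedances n p = {i \<in> {1..n - 1}. p i > i}"

definition descents :: "nat \<Rightarrow> (nat \<Rightarrow> nat) \<Rightarrow> nat set" where
  "descents n p = {i \<in> {1..n - 1}. p i > p (i + 1)}"

text \<open>The index sets ensure that the subtractions on \<open>nat\<close> below never truncate.\<close>

definition dexc :: "nat \<Rightarrow> (nat \<Rightarrow> nat) \<Rightarrow> nat" where
  "dexc n p = (\<Sum>i\<in>excedances n p. p i - i)"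

definition ddes :: "nat \<Rightarrow> (nat \<Rightarrow> nat) \<Rightarrow> nat" where
  "ddes n p = (\<Sum>i\<in>descents n p. p i - p (i + 1))"

definition inv_count :: "nat \<Rightarrow> (nat \<Rightarrow> nat) \<Rightarrow> nat" where
  "inv_count n p = card {(i, j). i \<in> {1..n} \<and> j \<in> {1..n} \<and> i < j \<and> p i > p j}"

definition bi_increasing :: "nat \<Rightarrow> (nat \<Rightarrow> nat) \<Rightarrow> bool" where
  "bi_increasing n p \<longleftrightarrow> inv_count n p = dexc n p"

end

theory Submission
  imports Defs "HOL-Library.Infinite_Set"
begin

text \<open>
  A permutation is bi-increasing iff every inversion has an excedance on the left and a position
  \<open>j\<close> with \<open>p j < j\<close> on the right. The \<^emph>\<open>low\<close> values \<open>p j < j\<close> are then the values that are not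
  left-to-right maxima; every descent bottom is low and no descent top is.

  Send such a \<open>p\<close> to the pair \<open>(N, V)\<close>, where \<open>N\<close> consists of the low values, and \<open>V\<close> of the descent
  tops together with the low values that are not descent bottoms. Read value by value, the pair is
  a Motzkin path with two kinds of level steps above height \<open>0\<close>, whose height after \<open>k\<close> is the
  number of descents crossing \<open>k\<close>; its area is \<open>ddes\<close>. The pair of excedance positions and excedance
  values gives a path of the same kind, of area \<open>dexc\<close>. Since \<open>(N, V)\<close> determines \<open>p\<close> and every such
  path comes from a bi-increasing permutation by excedances, this yields an injective, hence
  bijective, self-map of the bi-increasing permutations that carries \<open>ddes\<close> to \<open>dexc\<close>.
\<close>

section \<open>The two value sets attached to a word\<close>

definition low_values :: "(nat \<Rightarrow> nat) \<Rightarrow> nat set" where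
  "low_values p = p ` {j. p j < j}"

text \<open>The index \<open>i\<close> carries no bound: a permutation of \<open>{1..n}\<close>
  fixes 0 and every number above \<open>n\<close>, so no descent starts outside
  \<open>{1..n - 1}\<close>.\<close>

definition descent_tops :: "(nat \<Rightarrow> nat) \<Rightarrow> nat set" where
  "descent_tops p = p ` {i. p (Suc i) < p i}"

definition descent_bottoms :: "(nat \<Rightarrow> nat) \<Rightarrow> nat set" where
  "descent_bottoms p = (\<lambda>i. p (Suc i)) ` {i. p (Suc i) < p i}"

definition partner_values :: "(nat \<Rightarrow> nat) \<Rightarrow> nat set" where
  "partner_values p = descent_tops p \<union> (low_values p - descent_bottoms p)"

section \<open>Positions of excedances, descents and inversions\<close>

lemma permutes_interval_bound:
  fixes p :: "nat \<Rightarrow> nat"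
  assumes "p permutes {1..n}" "p i \<noteq> i"
  shows "1 \<le> i \<and> i \<le> n \<and> 1 \<le> p i \<and> p i \<le> n"
  using assms by (metis atLeastAtMost_iff permutes_in_image permutes_not_in)

lemma inversion_bound:
  fixes p :: "nat \<Rightarrow> nat"
  assumes "p permutes {1..n}" "i < j" "p j < p i"
  shows "1 \<le> i \<and> j \<le> n"
proof -
  have "p 0 = 0" using assms(1) by (simp add: permutes_def)
  then have "i \<noteq> 0" using assms(3) by (metis not_less0)
  moreover have "j \<le> n"
  proof (rule ccontr)
    assume "\<not> j \<le> n"
    then have "p j = j" using assms(1) by (simp add: permutes_def)
    then show False
      using assms permutes_interval_bound[OF assms(1), of i] \<open>\<not> j \<le> n\<close> by (cases "p i = i") auto
  qed
  ultimately show ?thesis by simp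
qed

lemma excedances_permutes:
  assumes "p permutes {1..n}"
  shows "excedances n p = {i. i < p i}"
proof -
  have "i \<in> {1..n - 1}" if "i < p i" for i
    using permutes_interval_bound[OF assms, of i] that by auto
  then show ?thesis by (auto simp: excedances_def)
qed

lemma descents_permutes:
  assumes "p permutes {1..n}"
  shows "descents n p = {i. p (Suc i) < p i}"
proof -
  have "i \<in> {1..n - 1}" if "p (Suc i) < p i" for i
    using inversion_bound[OF assms _ that] by auto
  then show ?thesis by (auto simp: descents_def)
qed

section \<open>Bi-increasing permutations through their inversions\<close>

lemma card_right_smaller:
  assumes p: "p permutes {1..n}" and i: "i \<in> {1..n}"
  shows "card {j \<in> {1..n}. i < j \<and> p j < p i} + i = p i + card {j \<in> {1..n}. j < i \<and> p i < p j}"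
proof -
  have inj: "inj p" using p by (rule permutes_inj)
  have pi: "p i \<in> {1..n}" using permutes_in_image[OF p] i by blast
  \<comment> \<open>\<open>?M\<close> is shared by two counts: with \<open>?R\<close> it makes up
    the \<open>p i - 1\<close> smaller values, with \<open>?L\<close> the \<open>i - 1\<close>
    earlier positions.\<close>
  let ?R = "{j \<in> {1..n}. i < j \<and> p j < p i}"
  let ?L = "{j \<in> {1..n}. j < i \<and> p i < p j}"
  let ?M = "{j \<in> {1..n}. j < i \<and> p j < p i}"
  have "p ` {j \<in> {1..n}. p j < p i} = {1..<p i}"
  proof
    show "p ` {j \<in> {1..n}. p j < p i} \<subseteq> {1..<p i}"
      using permutes_in_image[OF p] by fastforce
    show "{1..<p i} \<subseteq> p ` {j \<in> {1..n}. p j < p i}"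
    proof
      fix y assume y: "y \<in> {1..<p i}"
      then have "y \<in> {1..n}" using pi by auto
      then have "y \<in> p ` {1..n}" using permutes_image[OF p] by simp
      then show "y \<in> p ` {j \<in> {1..n}. p j < p i}" using y by auto
    qed
  qed
  moreover have "card (p ` {j \<in> {1..n}. p j < p i}) = card {j \<in> {1..n}. p j < p i}"
    using inj by (intro card_image) (auto intro: inj_on_subset)
  ultimately have 1: "card {j \<in> {1..n}. p j < p i} = p i - 1" by simp
  have "{j \<in> {1..n}. p j < p i} = ?R \<union> ?M"
    by (auto simp: not_less_iff_gr_or_eq)
  moreover have "card (?R \<union> ?M) = card ?R + card ?M" by (rule card_Un_disjoint) auto
  ultimately have 2: "card ?R + card ?M = p i - 1" using 1 by simp
  have "{1..<i} = ?L \<union> ?M"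
  proof -
    have "p j \<noteq> p i" if "j < i" for j using inj that by (auto dest: injD)
    then show ?thesis using i by (fastforce simp: nat_neq_iff)
  qed
  moreover have "card (?L \<union> ?M) = card ?L + card ?M" by (rule card_Un_disjoint) auto
  ultimately have 3: "card ?L + card ?M = i - 1" by (metis card_atLeastLessThan)
  show ?thesis using 2 3 i pi by auto
qed

lemma inv_count_eq_sum:
  "inv_count n p = (\<Sum>i\<in>{1..n}. card {j \<in> {1..n}. i < j \<and> p j < p i})"
proof -
  have "{(i, j). i \<in> {1..n} \<and> j \<in> {1..n} \<and> i < j \<and> p i > p j}
      = Sigma {1..n} (\<lambda>i. {j \<in> {1..n}. i < j \<and> p j < p i})" by auto
  then show ?thesis by (simp add: inv_count_def)
qed

text \<open>Truncated subtraction lets every non-excedance contribute 0.\<close>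

lemma dexc_eq_sum:
  assumes "p permutes {1..n}"
  shows "dexc n p = (\<Sum>i\<in>{1..n}. p i - i)"
  unfolding dexc_def by (rule sum.mono_neutral_left) (auto simp: excedances_permutes[OF assms]
      dest: permutes_interval_bound[OF assms, OF less_imp_neq[symmetric]])

text \<open>By \<open>card_right_smaller\<close>, each summand of \<open>inv_count\<close> is at
  least the matching summand \<open>p i - i\<close> of \<open>dexc\<close>, so equal totals force
  equality term by term.\<close>

lemma bi_increasing_iff_card:
  assumes p: "p permutes {1..n}"
  shows "bi_increasing n p \<longleftrightarrow> (\<forall>i\<in>{1..n}. card {j \<in> {1..n}. i < j \<and> p j < p i} = p i - i)"
    (is "_ \<longleftrightarrow> (\<forall>i\<in>_. ?r i = _)")
proof -
  have le: "p i - i \<le> ?r i" if "i \<in> {1..n}" for i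
    using card_right_smaller[OF p that] by linarith
  show ?thesis
  proof
    assume "bi_increasing n p"
    then have "(\<Sum>i\<in>{1..n}. p i - i) = (\<Sum>i\<in>{1..n}. ?r i)"
      by (simp add: bi_increasing_def inv_count_eq_sum dexc_eq_sum[OF p])
    from sum_mono_inv[OF this le]
    show "\<forall>i\<in>{1..n}. ?r i = p i - i" by auto
  next
    assume "\<forall>i\<in>{1..n}. ?r i = p i - i"
    then show "bi_increasing n p"
      by (simp add: bi_increasing_def inv_count_eq_sum dexc_eq_sum[OF p])
  qed
qed

text \<open>The smaller letter on the right makes the count at \<open>i\<close> positive, and this
  count is \<open>p i - i\<close>. At \<open>j\<close> the count is \<open>p j - j\<close>, so
  \<open>p j \<ge> j\<close> would leave no larger letter on the left of \<open>j\<close>.\<close>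

lemma bi_increasing_inversion:
  assumes p: "p permutes {1..n}" and bi: "bi_increasing n p" and ij: "i < j" "p j < p i"
  shows "i < p i \<and> p j < j"
proof -
  have "1 \<le> i \<and> j \<le> n" using inversion_bound[OF p ij] .
  then have mem: "i \<in> {1..n}" "j \<in> {1..n}" using ij by auto
  have card: "card {j' \<in> {1..n}. k < j' \<and> p j' < p k} = p k - k" if "k \<in> {1..n}" for k
    using bi bi_increasing_iff_card[OF p] that by blast
  have "j \<in> {j' \<in> {1..n}. i < j' \<and> p j' < p i}" using ij mem by simp
  then have "card {j' \<in> {1..n}. i < j' \<and> p j' < p i} > 0" by (auto simp: card_gt_0_iff)
  then have "i < p i" using card[OF mem(1)] by simp
  have "i \<in> {j' \<in> {1..n}. j' < j \<and> p j < p j'}" using ij mem by simp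
  then have "card {j' \<in> {1..n}. j' < j \<and> p j < p j'} > 0" by (auto simp: card_gt_0_iff)
  then have "p j < j" using card_right_smaller[OF p mem(2)] card[OF mem(2)] by linarith
  with \<open>i < p i\<close> show ?thesis by simp
qed

text \<open>An excedance has no larger letter before it and any other position no smaller letter
  after it, so \<open>card_right_smaller\<close> yields the required count in both cases.\<close>

lemma bi_increasingI:
  assumes p: "p permutes {1..n}"
    and inv: "\<And>i j. i < j \<Longrightarrow> p j < p i \<Longrightarrow> i < p i \<and> p j \<le> j"
  shows "bi_increasing n p"
  unfolding bi_increasing_iff_card[OF p]
proof
  fix i assume i: "i \<in> {1..n}"
  show "card {j \<in> {1..n}. i < j \<and> p j < p i} = p i - i"
  proof (cases "i < p i")
    case True
    then have "{j \<in> {1..n}. j < i \<and> p i < p j} = {}" using inv by force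
    then have "card {j \<in> {1..n}. j < i \<and> p i < p j} = 0" by (metis card.empty)
    then show ?thesis using card_right_smaller[OF p i] by linarith
  next
    case False
    then have "{j \<in> {1..n}. i < j \<and> p j < p i} = {}" using inv by blast
    then have "card {j \<in> {1..n}. i < j \<and> p j < p i} = 0" by (metis card.empty)
    then show ?thesis using False by linarith
  qed
qed

section \<open>Low values, descent tops and descent bottoms\<close>

lemma larger_before_low:
  fixes p :: "nat \<Rightarrow> nat"
  assumes p: "p permutes {1..n}" and "p j < j"
  shows "\<exists>i<j. p j < p i"
proof -
  have "j \<in> {1..n}" using permutes_interval_bound[OF p, of j] assms(2) by simp
  from card_right_smaller[OF p this] assms(2)
  have "card {i \<in> {1..n}. i < j \<and> p j < p i} \<noteq> 0" by linarith
  then have "{i \<in> {1..n}. i < j \<and> p j < p i} \<noteq> {}" by (metis card.empty)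
  then show ?thesis by blast
qed

lemma low_values_iff:
  "inj p \<Longrightarrow> p j \<in> low_values p \<longleftrightarrow> p j < j"
  by (auto simp: low_values_def dest: injD)

lemma bi_increasing_inversion_low:
  assumes p: "p permutes {1..n}" and bi: "bi_increasing n p" and ij: "i < j" "p j < p i"
  shows "p i \<notin> low_values p" "p j \<in> low_values p"
  using bi_increasing_inversion[OF p bi ij] low_values_iff[OF permutes_inj[OF p]] by auto

lemma low_values_subset:
  assumes p: "p permutes {1..n}"
  shows "low_values p \<subseteq> {1..n}"
proof
  fix x assume "x \<in> low_values p"
  then obtain j where "p j < j" "x = p j" by (auto simp: low_values_def)
  then show "x \<in> {1..n}" using permutes_interval_bound[OF p, of j] by auto
qed

lemma finite_descents:
  assumes "p permutes {1..n}"
  shows "finite {i. p (Suc i) < p i}"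
  using descents_permutes[OF assms, symmetric] by (simp add: descents_def)

lemma inj_on_shift:
  assumes "inj p"
  shows "inj_on p D" "inj_on (\<lambda>i. p (Suc i)) D"
  using assms by (auto simp: inj_on_def)

lemma descent_sets_low:
  assumes p: "p permutes {1..n}" and bi: "bi_increasing n p"
  shows "descent_tops p \<inter> low_values p = {}" "descent_bottoms p \<subseteq> low_values p"
  using bi_increasing_inversion_low[OF p bi, OF lessI]
  by (auto simp: descent_tops_def descent_bottoms_def)

lemma descent_tops_subset:
  assumes p: "p permutes {1..n}"
  shows "descent_tops p \<subseteq> {1..n}"
proof
  fix x assume "x \<in> descent_tops p"
  then obtain i where "p (Suc i) < p i" "x = p i" by (auto simp: descent_tops_def)
  then show "x \<in> {1..n}"
    using inversion_bound[OF p lessI] permutes_in_image[OF p, of i] by fastforce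
qed

text \<open>The partner values arise from the low values by exchanging the descent bottoms for the
  equally many descent tops. The exchange raises the sum by the total size of the drops, which is
  \<open>ddes\<close>.\<close>

lemma
  assumes p: "p permutes {1..n}" and bi: "bi_increasing n p"
  shows card_partner_values: "card (partner_values p) = card (low_values p)"
    and sum_partner_values: "\<Sum> (partner_values p) = ddes n p + \<Sum> (low_values p)"
proof -
  let ?D = "{i. p (Suc i) < p i}"
  have inj: "inj p" using p by (rule permutes_inj)
  have finN: "finite (low_values p)" using low_values_subset[OF p] finite_subset by blast
  have finT: "finite (descent_tops p)" using descent_tops_subset[OF p] finite_subset by blast
  have finB: "finite (descent_bottoms p)"
    using descent_sets_low(2)[OF p bi] finN finite_subset by blast
  have "card (descent_tops p) = card ?D" "card (descent_bottoms p) = card ?D"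
    unfolding descent_tops_def descent_bottoms_def
    by (rule card_image, rule inj_on_shift[OF inj])+
  then have "card (descent_tops p) = card (descent_bottoms p)" by simp
  moreover have "card (partner_values p) = card (descent_tops p) + card (low_values p - descent_bottoms p)"
    unfolding partner_values_def
    using descent_sets_low(1)[OF p bi] finN finT by (intro card_Un_disjoint) auto
  moreover have "card (low_values p - descent_bottoms p) + card (descent_bottoms p) = card (low_values p)"
    using descent_sets_low(2)[OF p bi] finB finN
    by (metis card_Diff_subset card_mono le_add_diff_inverse2)
  ultimately show "card (partner_values p) = card (low_values p)" by simp
  have "\<Sum> (descent_tops p) = (\<Sum>i\<in>?D. p i)"
    unfolding descent_tops_def by (simp add: sum.reindex[OF inj_on_shift(1)[OF inj]])
  moreover have "\<Sum> (descent_bottoms p) = (\<Sum>i\<in>?D. p (Suc i))"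
    unfolding descent_bottoms_def by (simp add: sum.reindex[OF inj_on_shift(2)[OF inj]])
  moreover have "ddes n p + (\<Sum>i\<in>?D. p (Suc i)) = (\<Sum>i\<in>?D. p i)"
    unfolding ddes_def descents_permutes[OF p] sum.distrib[symmetric] by (rule sum.cong) auto
  moreover have "\<Sum> (partner_values p) = \<Sum> (descent_tops p) + \<Sum> (low_values p - descent_bottoms p)"
    unfolding partner_values_def
    using descent_sets_low(1)[OF p bi] finN finT by (intro sum.union_disjoint) auto
  moreover have "\<Sum> (low_values p - descent_bottoms p) + \<Sum> (descent_bottoms p) = \<Sum> (low_values p)"
    using descent_sets_low(2)[OF p bi] finN by (metis sum.subset_diff)
  ultimately show "\<Sum> (partner_values p) = ddes n p + \<Sum> (low_values p)" by simp
qed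

section \<open>The ballot condition\<close>

lemma descent_across:
  assumes p: "p permutes {1..n}" and k: "k \<in> low_values p" "k \<notin> descent_bottoms p"
  shows "\<exists>i. p (Suc i) < k \<and> k < p i"
proof -
  obtain j where j: "p j < j" "k = p j" using k(1) by (auto simp: low_values_def)
  obtain i0 where i0: "i0 < j" "k < p i0" using larger_before_low[OF p j(1)] j(2) by auto
  \<comment> \<open>The last letter above \<open>k\<close> before position \<open>j\<close>: its
    successor is not above \<open>k\<close>, and it can equal \<open>k\<close> only if
    \<open>k\<close> is a descent bottom.\<close>
  define i where "i = Max {i. i < j \<and> k < p i}"
  have fin: "finite {i. i < j \<and> k < p i}" by simp
  have "i \<in> {i. i < j \<and> k < p i}"
    unfolding i_def using fin by (rule Max_in) (use i0 in auto)
  then have i: "i < j" "k < p i" by auto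
  have "Suc i \<noteq> j"
  proof
    assume "Suc i = j"
    then have "k \<in> descent_bottoms p" using i j by (auto simp: descent_bottoms_def)
    with k(2) show False ..
  qed
  moreover have "\<not> (Suc i < j \<and> k < p (Suc i))"
  proof
    assume "Suc i < j \<and> k < p (Suc i)"
    then have "Suc i \<le> i" unfolding i_def using Max_ge[OF fin, of "Suc i"] i_def by simp
    then show False by simp
  qed
  moreover have "p (Suc i) \<noteq> k" using permutes_inj[OF p] j(2) \<open>Suc i \<noteq> j\<close> by (auto dest: injD)
  ultimately have "p (Suc i) < k" using i(1) by linarith
  with i(2) show ?thesis by blast
qed

text \<open>A descent whose top is at most \<open>k\<close> has its bottom below \<open>k\<close>.
  Beyond that, only \<open>k\<close> itself, as a low value that is no descent bottom, can count on
  the left and not on the right; then \<open>descent_across\<close> supplies a descent with bottom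
  below and top above \<open>k\<close> to pay for it.\<close>

lemma partner_values_ballot:
  assumes p: "p permutes {1..n}" and bi: "bi_increasing n p"
  shows "card (partner_values p \<inter> {..k}) \<le> card (low_values p \<inter> {..<k})"
proof -
  let ?T = "descent_tops p" and ?B = "descent_bottoms p" and ?N = "low_values p"
  let ?D = "{i. p (Suc i) < p i}"
  let ?D1 = "{i \<in> ?D. p i \<le> k}" and ?D2 = "{i \<in> ?D. p (Suc i) < k}"
  have inj: "inj p" using p by (rule permutes_inj)
  have finN: "finite ?N" using low_values_subset[OF p] finite_subset by blast
  have finD: "finite ?D" using finite_descents[OF p] .
  have sub: "?D1 \<subseteq> ?D2" by auto
  have "?T \<inter> {..k} = p ` ?D1" by (auto simp: descent_tops_def)
  then have cT: "card (?T \<inter> {..k}) = card ?D1" by (simp add: card_image inj_on_shift[OF inj])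
  have "?B \<inter> {..<k} = (\<lambda>i. p (Suc i)) ` ?D2" by (auto simp: descent_bottoms_def)
  then have cB: "card (?B \<inter> {..<k}) = card ?D2" by (simp add: card_image inj_on_shift[OF inj])
  have "?N \<inter> {..<k} = (?B \<inter> {..<k}) \<union> ((?N - ?B) \<inter> {..<k})"
    using descent_sets_low(2)[OF p bi] by auto
  then have cN: "card (?N \<inter> {..<k}) = card ?D2 + card ((?N - ?B) \<inter> {..<k})"
    unfolding cB[symmetric] by (simp only:) (rule card_Un_disjoint, auto)
  have "partner_values p \<inter> {..k} = (?T \<inter> {..k}) \<union> ((?N - ?B) \<inter> {..k})"
    by (auto simp: partner_values_def)
  then have cV: "card (partner_values p \<inter> {..k}) \<le> card ?D1 + card ((?N - ?B) \<inter> {..k})"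
    unfolding cT[symmetric] by (simp only: card_Un_le)
  show ?thesis
  proof (cases "k \<in> ?N - ?B")
    case True
    then obtain i where "p (Suc i) < k" "k < p i" using descent_across[OF p] by auto
    then have "i \<in> ?D2" "i \<notin> ?D1" by auto
    then have "?D1 \<subset> ?D2" using sub by auto
    then have "card ?D1 < card ?D2" using finD by (intro psubset_card_mono) auto
    moreover have "(?N - ?B) \<inter> {..k} = insert k ((?N - ?B) \<inter> {..<k})" using True by auto
    then have "card ((?N - ?B) \<inter> {..k}) = Suc (card ((?N - ?B) \<inter> {..<k}))" by simp
    ultimately show ?thesis using cV cN by linarith
  next
    case False
    then have "(?N - ?B) \<inter> {..k} = (?N - ?B) \<inter> {..<k}" by (auto simp: order.order_iff_strict)
    moreover have "card ?D1 \<le> card ?D2" using finD sub by (intro card_mono) auto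
    ultimately show ?thesis using cV cN by simp
  qed
qed

section \<open>Recovering the word from the two sets\<close>

text \<open>
  In a bi-increasing word a low value is a descent bottom iff the letter before it is not low.
  At the first difference this forces the next letters of both words to be of the same kind.
\<close>

lemma first_difference_low:
  assumes p: "p permutes {1..n}" "bi_increasing n p"
    and q: "q permutes {1..n}" "bi_increasing n q"
    and N: "low_values p = low_values q"
    and T: "descent_tops p = descent_tops q" and B: "descent_bottoms p = descent_bottoms q"
    and eq: "\<And>j. j < i \<Longrightarrow> p j = q j" and qi: "q i \<in> low_values q"
  shows "p i \<in> low_values p"
proof (rule ccontr)
  assume pi: "p i \<notin> low_values p"
  have injp: "inj p" and injq: "inj q" using p q by (auto intro: permutes_inj)
  have "q i < i" using qi low_values_iff[OF injq] by simp
  then obtain m where i: "i = Suc m" by (cases i) auto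
  obtain a where a: "a < i" "q i < q a" using larger_before_low[OF q(1) \<open>q i < i\<close>] by auto
  have qa: "q a \<notin> low_values q" using bi_increasing_inversion_low(1)[OF q a] .
  show False
  proof (cases "q m \<in> low_values q")
    \<comment> \<open>Here \<open>q m\<close> is at least every earlier letter, so \<open>q\<close>
      descends at \<open>m\<close>. The descent top \<open>q m = p m\<close> is shared, so
      \<open>p i\<close> is a descent bottom of \<open>p\<close> and hence low.\<close>
    case False
    have "q a \<le> q m"
    proof (rule ccontr)
      assume "\<not> q a \<le> q m"
      moreover from this have "a < m" using a(1) i by (cases "a = m") auto
      ultimately show False using bi_increasing_inversion_low(2)[OF q, of a m] False by simp
    qed
    then have "q (Suc m) < q m" using a i by simp
    then have "q m \<in> descent_tops q" by (auto simp: descent_tops_def)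
    then have "p m \<in> descent_tops p" using T eq[of m] i by simp
    then have "p (Suc m) < p m" using injp by (auto simp: descent_tops_def inj_eq)
    then show False using bi_increasing_inversion_low(2)[OF p lessI, of m] pi i by simp
  next
    \<comment> \<open>Here \<open>q i\<close> is a descent bottom of neither word. In
      \<open>p\<close> it stands at some \<open>j > i\<close>; the letter before it turns out not to
      be low, which makes \<open>q i\<close> a descent bottom of \<open>p\<close> after all.\<close>
    case True
    have "q (Suc m) \<notin> descent_bottoms q"
    proof
      assume "q (Suc m) \<in> descent_bottoms q"
      then have "q (Suc m) < q m" using injq by (auto simp: descent_bottoms_def inj_eq)
      then show False using bi_increasing_inversion_low(1)[OF q lessI, of m] True by simp
    qed
    then have nB: "q i \<notin> descent_bottoms p" using B i by simp
    have lowp: "q i \<in> low_values p" using qi N by simp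
    then obtain j where j: "q i = p j" by (auto simp: low_values_def)
    have "j \<noteq> i" using lowp pi j by auto
    moreover have "\<not> j < i"
    proof
      assume "j < i"
      then have "q i = q j" using eq j by simp
      then show False using \<open>j < i\<close> injq by (simp add: inj_eq)
    qed
    ultimately have "i < j" by simp
    then obtain l where l: "j = Suc l" "i \<le> l" by (cases j) auto
    \<comment> \<open>Low values increase along each word. If \<open>p l\<close> were low it would
      be smaller than \<open>p j = q i\<close>, yet in \<open>q\<close> it occurs only after
      \<open>q i\<close>.\<close>
    have pl: "p l \<notin> low_values p"
    proof
      assume low: "p l \<in> low_values p"
      then have "p l \<in> low_values q" using N by simp
      then obtain b where b: "p l = q b" by (auto simp: low_values_def)
      have "l \<noteq> i" using low pi by auto
      have "\<not> b < i"
      proof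
        assume "b < i"
        then have "p l = p b" using eq b by simp
        then show False using \<open>b < i\<close> l injp by (simp add: inj_eq)
      qed
      moreover have "b \<noteq> i"
      proof
        assume "b = i"
        then have "p l = p j" using b j by simp
        then show False using l injp by (simp add: inj_eq)
      qed
      ultimately have "i < b" by simp
      moreover have "p l < p j"
      proof (rule ccontr)
        assume "\<not> p l < p j"
        moreover have "p l \<noteq> p j" using l injp by (simp add: inj_eq)
        ultimately have "p j < p l" by simp
        then show False using bi_increasing_inversion_low(1)[OF p, of l j] l low by simp
      qed
      ultimately show False using bi_increasing_inversion_low(1)[OF q, of i b] b j qi by simp
    qed
    have "p j < j" using lowp j low_values_iff[OF injp] by simp
    then obtain c where c: "c < j" "p j < p c" using larger_before_low[OF p(1)] by auto
    have "p c \<le> p l"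
    proof (rule ccontr)
      assume "\<not> p c \<le> p l"
      moreover from this have "c < l" using c(1) l by (cases "c = l") auto
      ultimately show False using bi_increasing_inversion_low(2)[OF p, of c l] pl by simp
    qed
    then have "p (Suc l) < p l" using c l by simp
    then have "q i \<in> descent_bottoms p" using j l by (auto simp: descent_bottoms_def)
    with nB show False ..
  qed
qed

text \<open>Otherwise the letter \<open>p i\<close> occurs in \<open>q\<close> after position
  \<open>i\<close> and forms an inversion with \<open>q i\<close>. Only the smaller end of an
  inversion is low, but both letters are of the same kind.\<close>

lemma first_difference_not_less:
  assumes p: "p permutes {1..n}"
    and q: "q permutes {1..n}" "bi_increasing n q"
    and N: "low_values p = low_values q"
    and eq: "\<And>j. j < i \<Longrightarrow> p j = q j"
    and same: "p i \<in> low_values p \<longleftrightarrow> q i \<in> low_values q"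
  shows "\<not> p i < q i"
proof
  assume less: "p i < q i"
  have injp: "inj p" using p by (rule permutes_inj)
  obtain j where j: "p i = q j" using permutes_surj[OF q(1)] by (metis surjD)
  have "\<not> j < i"
  proof
    assume "j < i"
    then have "p i = p j" using eq j by simp
    then show False using \<open>j < i\<close> injp by (simp add: inj_eq)
  qed
  then have "i < j" using less j by (cases "i = j") auto
  then show False using bi_increasing_inversion_low[OF q, of i j] less j same N by simp
qed

lemma low_partner_values_inject:
  assumes p: "p permutes {1..n}" "bi_increasing n p"
    and q: "q permutes {1..n}" "bi_increasing n q"
    and N: "low_values p = low_values q" and V: "partner_values p = partner_values q"
  shows "p = q"
proof -
  \<comment> \<open>Tops are never low and bottoms always are, so the two set differences recover
    both descent sets from the pair.\<close>
  have "descent_tops r = partner_values r - low_values r"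
    "descent_bottoms r = low_values r - partner_values r"
    if "r permutes {1..n}" "bi_increasing n r" for r
    using descent_sets_low[OF that] by (auto simp: partner_values_def)
  with p q N V have T: "descent_tops p = descent_tops q"
    and B: "descent_bottoms p = descent_bottoms q" by simp_all
  have "p i = q i" for i
  proof (induction i rule: less_induct)
    case (less i)
    then have eq: "\<And>j. j < i \<Longrightarrow> p j = q j" by simp
    have same: "p i \<in> low_values p \<longleftrightarrow> q i \<in> low_values q"
      using first_difference_low[OF p q N T B eq]
        first_difference_low[OF q p N[symmetric] T[symmetric] B[symmetric] eq[symmetric]] by blast
    show ?case
      using first_difference_not_less[OF p(1) q N eq same]
        first_difference_not_less[OF q(1) p N[symmetric] eq[symmetric] same[symmetric]] by simp
  qed
  then show ?thesis by auto
qed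

section \<open>Realizing a ballot pair by excedances\<close>

lemma finite_order_iso:
  fixes A B :: "nat set"
  assumes "finite A" "finite B" "card A = card B"
  obtains f where "bij_betw f A B" "strict_mono_on A f"
proof -
  obtain g where g: "bij_betw g {..<card A} A" "strict_mono_on {..<card A} g"
    by (rule ex_bij_betw_strict_mono_card[OF assms(1)])
  obtain h where h: "bij_betw h {..<card A} B" "strict_mono_on {..<card A} h"
    by (rule ex_bij_betw_strict_mono_card[OF assms(2), folded assms(3)])
  let ?g = "the_inv_into {..<card A} g"
  have bij: "bij_betw ?g A {..<card A}" using g(1) by (rule bij_betw_the_inv_into)
  have "strict_mono_on A ?g"
  proof (rule strict_mono_onI)
    fix x y assume xy: "x \<in> A" "y \<in> A" "x < y"
    have mem: "?g x \<in> {..<card A}" "?g y \<in> {..<card A}" using bij_betwE[OF bij] xy by auto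
    have "g (?g x) = x" "g (?g y) = y" using f_the_inv_into_f_bij_betw[OF g(1)] xy by auto
    then show "?g x < ?g y" using xy mem g(2) by (metis strict_mono_on_less)
  qed
  moreover have "strict_mono_on A (h \<circ> ?g)"
  proof (rule strict_mono_onI)
    fix x y assume xy: "x \<in> A" "y \<in> A" "x < y"
    have mem: "?g x \<in> {..<card A}" "?g y \<in> {..<card A}" using bij_betwE[OF bij] xy by auto
    show "(h \<circ> ?g) x < (h \<circ> ?g) y"
      using mem h(2) strict_mono_onD[OF \<open>strict_mono_on A ?g\<close> xy] by (simp add: strict_mono_on_def)
  qed
  ultimately show ?thesis using that[of "h \<circ> ?g"] bij_betw_trans[OF bij h(1)] by blast
qed

lemma card_order_iso_le:
  fixes f :: "nat \<Rightarrow> nat"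
  assumes "bij_betw f A B" "strict_mono_on A f" "x \<in> A"
  shows "card (B \<inter> {..f x}) = card (A \<inter> {..x})"
proof -
  have "B \<inter> {..f x} = f ` (A \<inter> {..x})"
    using assms by (auto simp: bij_betw_def strict_mono_on_leD strict_mono_on_less_eq)
  then show ?thesis using assms(1) by (metis bij_betw_def card_image inf_le1 inj_on_subset)
qed

text \<open>Map \<open>E\<close> to \<open>V\<close> and the complement of \<open>E\<close> to that
  of \<open>V\<close>, both increasingly. The ballot condition makes exactly the positions in
  \<open>E\<close> excedances, and then every inversion leads from \<open>E\<close> to its
  complement.\<close>

lemma ballot_pair_realizable:
  assumes E: "E \<subseteq> {1..n}" and V: "V \<subseteq> {1..n}" and card: "card E = card V"
    and ballot: "\<And>k. card (V \<inter> {..k}) \<le> card (E \<inter> {..<k})"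
  obtains p where "p permutes {1..n}" "bi_increasing n p" "{i. i < p i} = E" "p ` E = V"
proof -
  let ?I = "{1..n}"
  have fin: "finite E" "finite V" using E V finite_subset by auto
  obtain f where f: "bij_betw f E V" "strict_mono_on E f"
    by (rule finite_order_iso[OF fin card])
  have "card (?I - E) = card (?I - V)" using fin E V card by (metis card_Diff_subset)
  then obtain g where g: "bij_betw g (?I - E) (?I - V)" "strict_mono_on (?I - E) g"
    by (rule finite_order_iso[rotated 2]) auto
  \<comment> \<open>Otherwise the elements of \<open>V\<close> up to \<open>f x\<close>, as many as
    those of \<open>E\<close> up to \<open>x\<close>, would outnumber the elements of
    \<open>E\<close> below \<open>f x\<close>.\<close>
  have f_gt: "x < f x" if x: "x \<in> E" for x
  proof (rule ccontr)
    assume "\<not> x < f x"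
    have "card (E \<inter> {..x}) = card (V \<inter> {..f x})" using card_order_iso_le[OF f x] by simp
    also have "\<dots> \<le> card (E \<inter> {..<f x})" by (rule ballot)
    also have "\<dots> < card (E \<inter> {..x})"
      using \<open>\<not> x < f x\<close> x fin by (intro psubset_card_mono) auto
    finally show False by simp
  qed
  have split: "card ((?I - S) \<inter> {..x}) + card (S \<inter> {..x}) = x" if "x \<in> ?I" "S \<subseteq> ?I" for x S
  proof -
    have "card ((?I - S) \<inter> {..x}) + card (S \<inter> {..x}) = card ((?I - S) \<inter> {..x} \<union> S \<inter> {..x})"
      by (rule card_Un_disjoint[symmetric]) auto
    also have "(?I - S) \<inter> {..x} \<union> S \<inter> {..x} = {1..x}" using that by auto
    finally show ?thesis by simp
  qed
  \<comment> \<open>If \<open>g x > x\<close>, the complement of \<open>V\<close> has fewer elements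
    up to \<open>x\<close> than that of \<open>E\<close>, so \<open>V\<close> has more there than
    \<open>E\<close>.\<close>
  have g_le: "g x \<le> x" if x: "x \<in> ?I - E" for x
  proof (rule ccontr)
    assume "\<not> g x \<le> x"
    have gx: "g x \<in> ?I - V" using g(1) x by (auto simp: bij_betw_def)
    have "(?I - V) \<inter> {..x} \<subseteq> (?I - V) \<inter> {..g x}" using \<open>\<not> g x \<le> x\<close> by auto
    moreover have "g x \<in> (?I - V) \<inter> {..g x}" "g x \<notin> (?I - V) \<inter> {..x}"
      using \<open>\<not> g x \<le> x\<close> gx by simp_all
    ultimately have "(?I - V) \<inter> {..x} \<subset> (?I - V) \<inter> {..g x}" by blast
    then have "card ((?I - V) \<inter> {..x}) < card ((?I - V) \<inter> {..g x})"
      by (rule psubset_card_mono[rotated]) simp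
    also have "\<dots> = card ((?I - E) \<inter> {..x})" using card_order_iso_le[OF g x] .
    finally have "card (E \<inter> {..x}) < card (V \<inter> {..x})"
      using split[of x E] split[of x V] x E V by simp
    also have "\<dots> \<le> card (E \<inter> {..<x})" by (rule ballot)
    also have "\<dots> \<le> card (E \<inter> {..x})" using fin by (intro card_mono) auto
    finally show False by simp
  qed
  define p where "p x = (if x \<in> E then f x else if x \<in> ?I then g x else x)" for x
  have "bij_betw p E V" using f(1) by (subst bij_betw_cong[of E p f]) (auto simp: p_def)
  moreover have "bij_betw p (?I - E) (?I - V)"
    using g(1) by (subst bij_betw_cong[of "?I - E" p g]) (auto simp: p_def)
  ultimately have "bij_betw p (E \<union> (?I - E)) (V \<union> (?I - V))"
    by (rule bij_betw_combine) auto
  moreover have "E \<union> (?I - E) = ?I" "V \<union> (?I - V) = ?I" using E V by auto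
  ultimately have "bij_betw p ?I ?I" by simp
  then have perm: "p permutes ?I"
    by (rule bij_imp_permutes) (use E in \<open>auto simp: p_def\<close>)
  have gt: "x < p x" if "x \<in> E" for x using f_gt that by (simp add: p_def)
  have le: "p x \<le> x" if "x \<notin> E" for x using g_le that by (simp add: p_def)
  have "bi_increasing n p"
  proof (rule bi_increasingI[OF perm])
    fix i j assume ij: "i < j" "p j < p i"
    have bd: "1 \<le> i \<and> j \<le> n" using inversion_bound[OF perm ij] .
    have "\<not> (i \<in> E \<and> j \<in> E)"
      using ij f(2) by (auto simp: p_def dest: strict_mono_onD)
    moreover have "\<not> (i \<notin> E \<and> j \<notin> E)"
      using ij g(2) bd strict_mono_onD[OF g(2), of i j] by (auto simp: p_def split: if_splits)
    \<comment> \<open>In this case \<open>p i \<le> i < j < p j\<close>, so there is no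
      inversion.\<close>
    moreover have "\<not> (i \<notin> E \<and> j \<in> E)"
      using ij gt[of j] le[of i] by auto
    ultimately show "i < p i \<and> p j \<le> j" using gt le by blast
  qed
  moreover have "{i. i < p i} = E" using gt le by (auto simp: not_le[symmetric])
  moreover have "p ` E = V" using \<open>bij_betw p E V\<close> by (simp add: bij_betw_def)
  ultimately show ?thesis using that perm by blast
qed

section \<open>The bijection and its effect on the statistics\<close>

lemma dexc_excedance_sums:
  assumes "p permutes {1..n}"
  shows "dexc n p + \<Sum> {i. i < p i} = \<Sum> (p ` {i. i < p i})"
proof -
  have "\<Sum> (p ` {i. i < p i}) = (\<Sum>i\<in>{i. i < p i}. p i)"
    by (simp add: sum.reindex[OF inj_on_shift(1)[OF permutes_inj[OF assms]]])
  moreover have "dexc n p + \<Sum> {i. i < p i} = (\<Sum>i\<in>{i. i < p i}. p i)"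
    unfolding dexc_def excedances_permutes[OF assms] sum.distrib[symmetric] by (rule sum.cong) auto
  ultimately show ?thesis by simp
qed

lemma partner_permutation_exists:
  assumes p: "p permutes {1..n}" "bi_increasing n p"
  shows "\<exists>q. q permutes {1..n} \<and> bi_increasing n q \<and> {i. i < q i} = low_values p
    \<and> q ` {i. i < q i} = partner_values p"
proof -
  have "partner_values p \<subseteq> {1..n}"
    using descent_tops_subset[OF p(1)] low_values_subset[OF p(1)] by (auto simp: partner_values_def)
  from ballot_pair_realizable[OF low_values_subset[OF p(1)] this
      card_partner_values[OF p, symmetric] partner_values_ballot[OF p]]
  show ?thesis by metis
qed

theorem theorem5p1:
  fixes n k :: nat
  assumes "n \<ge> 1"
  shows "card {p. p permutes {1..n} \<and> bi_increasing n p \<and> dexc n p = k} =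
         card {p. p permutes {1..n} \<and> bi_increasing n p \<and> ddes n p = k}"
proof -
  let ?A = "{p. p permutes {1..n} \<and> bi_increasing n p}"
  have fin: "finite ?A"
    by (rule finite_subset[OF _ finite_permutations[of "{1..n}"]]) auto
  have "\<forall>p\<in>?A. \<exists>q. q \<in> ?A \<and> {i. i < q i} = low_values p \<and> q ` {i. i < q i} = partner_values p"
    using partner_permutation_exists by auto
  then obtain \<phi> where \<phi>: "\<And>p. p \<in> ?A \<Longrightarrow> \<phi> p \<in> ?A \<and> {i. i < \<phi> p i} = low_values p
      \<and> \<phi> p ` {i. i < \<phi> p i} = partner_values p"
    by metis
  have inj: "inj_on \<phi> ?A"
  proof (rule inj_onI)
    fix p q assume "p \<in> ?A" "q \<in> ?A" "\<phi> p = \<phi> q"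
    then show "p = q"
      using \<phi>[of p] \<phi>[of q] by (intro low_partner_values_inject[of p n q]) auto
  qed
  have "\<phi> ` ?A = ?A" using \<phi> by (intro endo_inj_surj[OF fin _ inj]) auto
  have stat: "dexc n (\<phi> p) = ddes n p" if "p \<in> ?A" for p
  proof -
    \<comment> \<open>The excedance positions and values of \<open>\<phi> p\<close> are the low and
      partner values of \<open>p\<close>, so the difference of the two sums is both
      \<open>dexc n (\<phi> p)\<close> and \<open>ddes n p\<close>.\<close>
    have "dexc n (\<phi> p) + \<Sum> (low_values p) = \<Sum> (partner_values p)"
      using dexc_excedance_sums[of "\<phi> p" n] \<phi>[OF that] by force
    then show ?thesis using sum_partner_values[of p n] that by simp
  qed
  have "\<phi> ` {p \<in> ?A. ddes n p = k} = {p \<in> ?A. dexc n p = k}"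
  proof
    show "\<phi> ` {p \<in> ?A. ddes n p = k} \<subseteq> {p \<in> ?A. dexc n p = k}"
      using \<phi> stat by auto
    show "{p \<in> ?A. dexc n p = k} \<subseteq> \<phi> ` {p \<in> ?A. ddes n p = k}"
    proof
      fix q assume q: "q \<in> {p \<in> ?A. dexc n p = k}"
      then obtain p where "p \<in> ?A" "q = \<phi> p" using \<open>\<phi> ` ?A = ?A\<close> by blast
      then show "q \<in> \<phi> ` {p \<in> ?A. ddes n p = k}" using stat q by auto
    qed
  qed
  moreover have "card (\<phi> ` {p \<in> ?A. ddes n p = k}) = card {p \<in> ?A. ddes n p = k}"
    by (rule card_image) (rule inj_on_subset[OF inj], auto)
  ultimately have "card {p \<in> ?A. dexc n p = k} = card {p \<in> ?A. ddes n p = k}" by simp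
  then show ?thesis by (simp add: conj_assoc)
qed

end
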